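(* Let $\alpha>0$, let $n$ be the positive integer with $n-1<\alpha\le n$, let $a\in\mathbb{R}$ and $a(\alpha)=a+n-1$. For every real-valued function $f$ defined on $\mathbb{N}_a$, $$({}^{C}\Delta_a^\alpha f)(t-\alpha)=({}^{C}\nabla_{a(\alpha)}^\alpha f)(t),\qquad t\in\mathbb{N}_{a+n}.$$
   Context: Notation: $\mathbb{N}_a=\{a,a+1,\dots\}$; $\Delta f(t)=f(t+1)-f(t)$, $\nabla f(t)=f(t)-f(t-1)$, with iterates $\Delta^m,\nabla^m$; $\sigma(t)=t+1$, $\rho(t)=t-1$. Falling function: $t^{(\beta)}=\Gamma(t+1)/\Gamma(t+1-\beta)$ (division by a pole gives $0$). Rising function: $t^{\overline{\beta}}=\Gamma(t+\beta)/\Gamma(t)$. Delta left Caputo fractional difference: for $n-1<\alpha<n$, $${}^{C}\Delta_a^\alpha f(t)=\frac{1}{\Gamma(n-\alpha)}\sum_{s=a}^{t-(n-\alpha)}(t-\sigma(s))^{(n-\alpha-1)}\Delta^n f(s),\quad t\in\mathbb{N}_{a+(n-\alpha)},$$ with $s$ running over $a,a+1,\dots$; for $\alpha=n$, ${}^{C}\Delta_a^n f(t)=\Delta^n f(t)$. Dual nabla left Caputo fractional difference: with $a(\alpha)=a+n-1$, for $n-1<\alpha<n$, $${}^{C}\nabla_{a(\alpha)}^\alpha f(t)=\nabla_{a(\alpha)}^{-(n-\alpha)}\nabla^n f(t)=\frac{1}{\Gamma(n-\alpha)}\sum_{s=a(\alpha)+1}^{t}(t-\rho(s))^{\overline{n-\alpha-1}}\nabla^n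 f(s),\quad t\in\mathbb{N}_{a+n};$$ for $\alpha=n$ it is $\nabla^n f(t)$. *)

theory Defs
  imports "HOL-Analysis.Analysis"
begin

definition nats_from :: "real \<Rightarrow> real set" where
  "nats_from a = {a + real k | k. True}"

definition fwd_diff :: "(real \<Rightarrow> real) \<Rightarrow> real \<Rightarrow> real" where
  "fwd_diff f t = f (t + 1) - f t"

definition bwd_diff :: "(real \<Rightarrow> real) \<Rightarrow> real \<Rightarrow> real" where
  "bwd_diff f t = f t - f (t - 1)"

definition fwd_jump :: "real \<Rightarrow> real" where
  "fwd_jump t = t + 1"

definition bwd_jump :: "real \<Rightarrow> real" where
  "bwd_jump t = t - 1"

(* Since Gamma is 0 at its poles and x / 0 = 0, division by a pole gives 0, as
   the usual convention for these functions demands. *)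

definition falling_fun :: "real \<Rightarrow> real \<Rightarrow> real" where
  "falling_fun t \<beta> = Gamma (t + 1) / Gamma (t + 1 - \<beta>)"

definition rising_fun :: "real \<Rightarrow> real \<Rightarrow> real" where
  "rising_fun t \<beta> = Gamma (t + \<beta>) / Gamma t"

(* The operators below are total, but meaningful only for order \<alpha> > 0, where
   nat (ceiling \<alpha>) is the positive integer n with n - 1 < \<alpha> \<le> n, and for t in
   nats_from (a + (n - \<alpha>)) in the delta case, t in nats_from (b + 1) in the
   nabla case. *)

definition caputo_delta :: "real \<Rightarrow> real \<Rightarrow> (real \<Rightarrow> real) \<Rightarrow> real \<Rightarrow> real" where
  "caputo_delta a \<alpha> f t =
     (let n = nat \<lceil>\<alpha>\<rceil> in
      if \<alpha> = real n then (fwd_diff ^^ n) f t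
      else 1 / Gamma (real n - \<alpha>) *
        (\<Sum>s \<in> {s \<in> nats_from a. s \<le> t - (real n - \<alpha>)}.
           falling_fun (t - fwd_jump s) (real n - \<alpha> - 1) * (fwd_diff ^^ n) f s))"

(* nabla_sum b \<nu> is the nabla operator of order -\<nu> based at b. *)

definition nabla_sum :: "real \<Rightarrow> real \<Rightarrow> (real \<Rightarrow> real) \<Rightarrow> real \<Rightarrow> real" where
  "nabla_sum b \<nu> g t =
     1 / Gamma \<nu> *
       (\<Sum>s \<in> {s \<in> nats_from (b + 1). s \<le> t}.
          rising_fun (t - bwd_jump s) (\<nu> - 1) * g s)"

(* b is the base point of the operator itself; the dual of caputo_delta a \<alpha> is
   obtained for b = a + n - 1. *)

definition caputo_nabla :: "real \<Rightarrow> real \<Rightarrow> (real \<Rightarrow> real) \<Rightarrow> real \<Rightarrow> real" where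
  "caputo_nabla b \<alpha> f t =
     (let n = nat \<lceil>\<alpha>\<rceil> in
      if \<alpha> = real n then (bwd_diff ^^ n) f t
      else nabla_sum b (real n - \<alpha>) ((bwd_diff ^^ n) f) t)"

end

theory Submission
  imports Defs
begin

text \<open>The shift \<open>s \<mapsto> s + n\<close> matches the delta sum at \<open>t - \<alpha>\<close> with the nabla sum at \<open>t\<close>
  term by term. It carries \<open>a, a + 1, \<dots>, t - n\<close> onto \<open>a + n, \<dots>, t\<close>; the differences agree
  because \<open>\<Delta>\<^sup>n f\<close> at \<open>s\<close> and \<open>\<nabla>\<^sup>n f\<close> at \<open>s + n\<close> are the same alternating combination of
  \<open>f s, \<dots>, f (s + n)\<close> (\<open>funpow_bwd_diff_shift\<close>); and both kernels reduce to
  \<open>\<Gamma>(t - s - \<alpha>) / \<Gamma>(t - s - n + 1)\<close>, an instance of \<open>falling_fun_eq_rising_fun\<close>.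
  For \<open>\<alpha> = n\<close> the identity for the differences is already the whole claim.\<close>

lemma funpow_bwd_diff_shift:
  "(bwd_diff ^^ n) f (s + real n) = (fwd_diff ^^ n) f s"
proof (induction n arbitrary: s)
  case 0
  then show ?case by simp
next
  case (Suc n)
  have "(bwd_diff ^^ Suc n) f (s + real (Suc n))
      = (bwd_diff ^^ n) f (s + 1 + real n) - (bwd_diff ^^ n) f (s + real n)"
    by (simp add: bwd_diff_def add_ac)
  also have "\<dots> = (fwd_diff ^^ Suc n) f s"
    unfolding Suc.IH by (simp add: fwd_diff_def)
  finally show ?case .
qed

text \<open>Both sides are literally the same quotient of Gamma values, so they also agree where
  the numerator or the denominator sits at a pole.\<close>

lemma falling_fun_eq_rising_fun: "falling_fun x \<beta> = rising_fun (x + 1 - \<beta>) \<beta>"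
  by (simp add: falling_fun_def rising_fun_def)

lemma bij_betw_nats_from_shift:
  "bij_betw (\<lambda>s. s + c) {s \<in> nats_from a. s \<le> u} {s \<in> nats_from (a + c). s \<le> u + c}"
  by (rule bij_betw_byWitness[where f' = "\<lambda>s. s - c"]) (auto simp: nats_from_def)

theorem proposition5p1:
  fixes \<alpha> a :: real and n :: nat and f :: "real \<Rightarrow> real"
  assumes "\<alpha> > 0" and "n > 0" and "real n - 1 < \<alpha>" and "\<alpha> \<le> real n"
  shows "\<forall>t \<in> nats_from (a + real n).
    caputo_delta a \<alpha> f (t - \<alpha>) = caputo_nabla (a + real n - 1) \<alpha> f t"
proof
  fix t assume "t \<in> nats_from (a + real n)"
  have "\<lceil>\<alpha>\<rceil> = int n"
    using assms by (simp add: ceiling_eq_iff)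
  then have n: "nat \<lceil>\<alpha>\<rceil> = n" by simp
  show "caputo_delta a \<alpha> f (t - \<alpha>) = caputo_nabla (a + real n - 1) \<alpha> f t"
  proof (cases "\<alpha> = real n")
    case True
    then show ?thesis
      using funpow_bwd_diff_shift[of n f "t - real n"]
      by (simp add: caputo_delta_def caputo_nabla_def)
  next
    case False
    let ?\<nu> = "real n - \<alpha>"
    have kernel: "falling_fun (t - \<alpha> - fwd_jump s) (?\<nu> - 1)
        = rising_fun (t - bwd_jump (s + real n)) (?\<nu> - 1)" for s
      unfolding falling_fun_eq_rising_fun fwd_jump_def bwd_jump_def
      by (simp add: algebra_simps)
    have "(\<Sum>s \<in> {s \<in> nats_from a. s \<le> t - real n}.
            falling_fun (t - \<alpha> - fwd_jump s) (?\<nu> - 1) * (fwd_diff ^^ n) f s)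
        = (\<Sum>s \<in> {s \<in> nats_from (a + real n). s \<le> t}.
            rising_fun (t - bwd_jump s) (?\<nu> - 1) * (bwd_diff ^^ n) f s)"
      unfolding kernel funpow_bwd_diff_shift[symmetric]
      using sum.reindex_bij_betw[OF bij_betw_nats_from_shift[of "real n" a "t - real n"]]
      by simp
    then show ?thesis
      using False by (simp add: caputo_delta_def caputo_nabla_def nabla_sum_def n)
  qed
qed

end
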